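(* Let $n$ be a positive integer coprime to $4$ (i.e. $n$ is odd). Then the Alexander polynomial of the torus knot $T(n,4)$ is expressed through Alexander polynomials of torus knots $T(k,2)$ by $$\Delta_{n,4}(t)=\sum_{j=0}^{d_1}(-1)^{j}\,\Delta_{3n-2-4j,\,2}(t)+\sum_{i=0}^{d_2}(-1)^{i}\,\Delta_{n-2-4i,\,2}(t),$$ where $d_1=\left[\frac{3n-2}{4}\right]$ and $d_2=\left[\frac{n-2}{4}\right]$.
   Context: For coprime positive integers $n,l$, $\Delta_{n,l}(t)$ denotes the Alexander polynomial of the torus knot $T(n,l)$, normalized by the skein relation $\Delta_{+}(t)=(t^{1/2}-t^{-1/2})\Delta_{O}(t)+\Delta_{-}(t)$ together with $\Delta_{\rm unknot}=1$. It is the Laurent polynomial in $t$ given by the known formula $$\Delta_{n,l}(t)=\frac{(t^{nl/2}-t^{-nl/2})(t^{1/2}-t^{-1/2})}{(t^{n/2}-t^{-n/2})(t^{l/2}-t^{-l/2})}.$$ In particular, for odd $k\ge 1$, $\Delta_{k,2}(t)=\dfrac{t^{k/2}+t^{-k/2}}{t^{1/2}+t^{-1/2}}$ (so $\Delta_{1,2}=1$, $\Delta_{3,2}=t-1+t^{-1}$), and for odd $n$, $\Delta_{n,4}(t)=\dfrac{t^{3n/2}+t^{n/2}+t^{-n/2}+t^{-3n/2}}{t^{3/2}+t^{1/2}+t^{-1/2}+t^{-3/2}}$. Here $[y]$ denotes the integer part (floor) of $y$, and a sum $\sum_{i=0}^{d}$ with $d=-1$ is empty, hence $0$. *)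

theory Defs
  imports "HOL-Computational_Algebra.Formal_Laurent_Series"
begin

text \<open>
  Laurent polynomials in \<open>t^(1/2)\<close> over the integers are regarded as elements of the field of
  formal Laurent series over the rationals whose variable \<^term>\<open>fls_X\<close> stands for
  \<open>t^(1/2)\<close>. The embedding is injective, and the quotient below is a quotient in a field.
\<close>

definition t_half :: "int \<Rightarrow> rat fls" where
  "t_half k = fls_X powi k"  \<comment> \<open>\<open>t\<close> to the power \<open>k / 2\<close>\<close>

text \<open>
  The Alexander polynomial of the torus knot \<open>T(n, l)\<close>, for coprime positive \<open>n\<close> and \<open>l\<close>,
  in the normalization in which the unknot has polynomial 1 and
  \<open>\<Delta>\<^sub>+ = (t^(1/2) - t^(-1/2)) \<Delta>\<^sub>O + \<Delta>\<^sub>-\<close>. The values at other arguments carry no meaning.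
\<close>

definition torus_alexander :: "int \<Rightarrow> int \<Rightarrow> rat fls" where
  "torus_alexander n l =
     ((t_half (n * l) - t_half (- (n * l))) * (t_half 1 - t_half (- 1))) /
     ((t_half n - t_half (- n)) * (t_half l - t_half (- l)))"

lemma t_half_add: "t_half (a + b) = t_half a * t_half b"
  unfolding t_half_def by (rule power_int_add) simp

lemma t_half_0 [simp]: "t_half 0 = 1"
  by (simp add: t_half_def)

lemma t_half_eq_iff [simp]: "t_half a = t_half b \<longleftrightarrow> a = b"
proof
  assume "t_half a = t_half b"
  then have "fls_subdegree (t_half a) = fls_subdegree (t_half b)" by simp
  then show "a = b" by (simp add: t_half_def fls_X_power_int)
qed simp

lemma t_half_denominator_nonzero: "k \<noteq> 0 \<Longrightarrow> t_half k - t_half (- k) \<noteq> 0"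
  by simp

lemma torus_alexander_commute: "torus_alexander n l = torus_alexander l n"
  by (simp add: torus_alexander_def mult.commute)

lemma torus_alexander_unknot: "n \<noteq> 0 \<Longrightarrow> torus_alexander n 1 = 1"
  by (simp add: torus_alexander_def)

lemma t_half_diff_double:
  "t_half (2 * k) - t_half (- (2 * k)) = (t_half k - t_half (- k)) * (t_half k + t_half (- k))"
proof -
  have "t_half (2 * k) = t_half k * t_half k" "t_half (- (2 * k)) = t_half (- k) * t_half (- k)"
    by (simp_all flip: t_half_add)
  then show ?thesis by (simp add: algebra_simps)
qed

lemma torus_alexander_2:
  assumes "k \<noteq> 0"
  shows "torus_alexander k 2 = (t_half k + t_half (- k)) / (t_half 1 + t_half (- 1))"
  using assms t_half_diff_double [of k] t_half_diff_double [of 1]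
  by (simp add: torus_alexander_def mult.commute [of k 2])

lemma torus_alexander_trefoil: "torus_alexander 3 2 = t_half 2 - 1 + t_half (- 2)"
proof -
  have "t_half 1 + t_half (- 1) \<noteq> 0"
    using t_half_diff_double [of 1] t_half_denominator_nonzero [of 2] by auto
  moreover have "(t_half 2 - 1 + t_half (- 2)) * (t_half 1 + t_half (- 1)) = t_half 3 + t_half (- 3)"
    by (simp add: algebra_simps flip: t_half_add)
  ultimately show ?thesis
    by (simp add: torus_alexander_2 divide_eq_eq)
qed

end

theory Submission
  imports Defs
begin

text \<open>
  Write \<open>c\<^sub>k = t^(k/2) + t^(-k/2)\<close>. By repeated use of \<open>t^k - t^(-k) = (t^(k/2) - t^(-k/2)) c\<^sub>k\<close>,
  the polynomial of \<open>T(n, 4)\<close> is \<open>c\<^sub>n c\<^sub>2\<^sub>n / (c\<^sub>1 c\<^sub>2)\<close>, and that of \<open>T(k, 2)\<close> is \<open>c\<^sub>k / c\<^sub>1\<close>.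
  The product formula \<open>c\<^sub>a c\<^sub>b = c\<^sub>a\<^sub>+\<^sub>b + c\<^sub>a\<^sub>-\<^sub>b\<close> turns the numerator of the former into
  \<open>c\<^sub>3\<^sub>n + c\<^sub>n\<close>. It also gives \<open>c\<^sub>2 c\<^sub>k = c\<^sub>k\<^sub>+\<^sub>2 + c\<^sub>k\<^sub>-\<^sub>2\<close>, so after multiplication by \<open>c\<^sub>2\<close> an
  alternating sum of \<open>c\<^sub>k\<close> over indices in steps of four telescopes
  (\<open>alternating_sum_torus_2\<close>). The leading ends of the two sums in the theorem are \<open>c\<^sub>3\<^sub>n\<close>
  and \<open>c\<^sub>n\<close>; the trailing ends are both \<open>\<plusminus> c\<^sub>1\<close>, because \<open>n\<close> is odd, and the parities of
  \<open>d\<^sub>1\<close> and \<open>d\<^sub>2\<close> make them cancel.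
\<close>

definition t_half_sym :: "int \<Rightarrow> rat fls" where
  "t_half_sym k = t_half k + t_half (- k)"

lemma t_half_sym_uminus: "t_half_sym (- k) = t_half_sym k"
  by (simp add: t_half_sym_def add.commute)

lemma t_half_sym_mult: "t_half_sym a * t_half_sym b = t_half_sym (a + b) + t_half_sym (a - b)"
  by (simp add: t_half_sym_def algebra_simps flip: t_half_add)

lemma t_half_sym_nonzero: "k \<noteq> 0 \<Longrightarrow> t_half_sym k \<noteq> 0"
  using t_half_diff_double [of k] t_half_denominator_nonzero [of "2 * k"]
  by (auto simp: t_half_sym_def)

lemma torus_alexander_2_sym: "k \<noteq> 0 \<Longrightarrow> torus_alexander k 2 = t_half_sym k / t_half_sym 1"
  by (simp add: torus_alexander_2 t_half_sym_def)

lemma torus_alexander_4_sym: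
  assumes "n \<noteq> 0"
  shows "torus_alexander n 4 =
           (t_half_sym (3 * n) + t_half_sym n) / (t_half_sym 1 * t_half_sym 2)"
proof -
  define s where "s k = t_half k - t_half (- k)" for k
  have double: "s (2 * k) = s k * t_half_sym k" for k
    unfolding s_def t_half_sym_def by (rule t_half_diff_double)
  have quadruple: "s (4 * k) = s k * (t_half_sym k * t_half_sym (2 * k))" for k
    using double [of k] double [of "2 * k"] by (simp add: mult.assoc)
  have "s n \<noteq> 0" "s 1 \<noteq> 0"
    using assms by (simp_all add: s_def)
  have "torus_alexander n 4 = (s (4 * n) * s 1) / (s n * s 4)"
    by (simp add: torus_alexander_def s_def mult.commute [of n 4])
  also have "\<dots> = (t_half_sym n * t_half_sym (2 * n)) / (t_half_sym 1 * t_half_sym 2)"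
    using quadruple [of n] quadruple [of 1] \<open>s n \<noteq> 0\<close> \<open>s 1 \<noteq> 0\<close> by simp
  also have "t_half_sym n * t_half_sym (2 * n) = t_half_sym (3 * n) + t_half_sym n"
    using t_half_sym_mult [of "2 * n" n] by (simp add: mult.commute)
  finally show ?thesis .
qed

text \<open>
  Each summand contributes \<open>\<plusminus> (c\<^sub>m\<^sub>-\<^sub>4\<^sub>j\<^sub>+\<^sub>2 + c\<^sub>m\<^sub>-\<^sub>4\<^sub>j\<^sub>-\<^sub>2)\<close>, and its second part cancels against the
  first part of the next summand. The induction starts at the empty sum \<open>d = -1\<close>, where the two ends
  cancel each other; this case is needed when \<open>n = 1\<close>. Oddness of \<open>m\<close> keeps every index away
  from \<open>0\<close>, where \<open>torus_alexander\<close> is a division by zero.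
\<close>

lemma alternating_sum_torus_2:
  assumes "odd m" and "d \<ge> - 1"
  shows "(\<Sum>j = 0..d. (- 1) powi j * torus_alexander (m - 4 * j) 2) *
           (t_half_sym 1 * t_half_sym 2) =
         t_half_sym (m + 2) + (- 1) powi d * t_half_sym (m - 2 - 4 * d)"
  using assms(2)
proof (induction d rule: int_ge_induct)
  case base
  then show ?case by (simp add: add.commute)
next
  case (step d)
  let ?k = "m - 4 * (d + 1)"
  have "?k \<noteq> 0"
    using \<open>odd m\<close> by presburger
  then have "torus_alexander ?k 2 * (t_half_sym 1 * t_half_sym 2) = t_half_sym ?k * t_half_sym 2"
    by (simp add: torus_alexander_2_sym t_half_sym_nonzero)
  also have "\<dots> = t_half_sym (m - 2 - 4 * d) + t_half_sym (m - 2 - 4 * (d + 1))"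
    unfolding t_half_sym_mult by (simp add: algebra_simps)
  finally have new: "torus_alexander ?k 2 * (t_half_sym 1 * t_half_sym 2) =
      t_half_sym (m - 2 - 4 * d) + t_half_sym (m - 2 - 4 * (d + 1))" .
  have sign: "(- 1 :: rat fls) powi (d + 1) = - ((- 1) powi d)"
    by (simp add: power_int_add)
  have "{0..d + 1} = insert (d + 1) {0..d}"
    using step.hyps by auto
  then have "(\<Sum>j = 0..d + 1. (- 1) powi j * torus_alexander (m - 4 * j) 2) =
      (- 1) powi (d + 1) * torus_alexander ?k 2 +
      (\<Sum>j = 0..d. (- 1) powi j * torus_alexander (m - 4 * j) 2)"
    by simp
  then have "(\<Sum>j = 0..d + 1. (- 1) powi j * torus_alexander (m - 4 * j) 2) *
        (t_half_sym 1 * t_half_sym 2) =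
      (- 1) powi (d + 1) * (torus_alexander ?k 2 * (t_half_sym 1 * t_half_sym 2)) +
      (\<Sum>j = 0..d. (- 1) powi j * torus_alexander (m - 4 * j) 2) *
        (t_half_sym 1 * t_half_sym 2)"
    by (simp only: distrib_right mult.assoc)
  also have "\<dots> = t_half_sym (m + 2) + (- 1) powi (d + 1) * t_half_sym (m - 2 - 4 * (d + 1))"
    unfolding new step.IH sign by (simp only: distrib_left) simp
  finally show ?case .
qed

theorem proposition2:
  fixes n d1 d2 :: int
  assumes "n > 0" and "coprime n 4"
    and "d1 = \<lfloor>rat_of_int (3 * n - 2) / 4\<rfloor>"
    and "d2 = \<lfloor>rat_of_int (n - 2) / 4\<rfloor>"
  shows "torus_alexander n 4 =
           (\<Sum>j = 0..d1. (- 1) powi j * torus_alexander (3 * n - 2 - 4 * j) 2) +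
           (\<Sum>i = 0..d2. (- 1) powi i * torus_alexander (n - 2 - 4 * i) 2)"
    (is "_ = ?S1 + ?S2")
proof -
  let ?D = "t_half_sym 1 * t_half_sym 2"
  have "odd n"
    using \<open>coprime n 4\<close> coprime_common_divisor [of n 4 2] by auto
  have d1: "d1 = (3 * n - 2) div 4" and d2: "d2 = (n - 2) div 4"
    using assms(3,4) floor_divide_of_int_eq [of "3 * n - 2" 4, where ?'a = rat]
      floor_divide_of_int_eq [of "n - 2" 4, where ?'a = rat] by simp_all
  have S1: "?S1 * ?D = t_half_sym (3 * n) + (- 1) powi d1 * t_half_sym (3 * n - 4 - 4 * d1)"
    using alternating_sum_torus_2 [of "3 * n - 2" d1] \<open>odd n\<close> \<open>n > 0\<close> d1 by simp
  have S2: "?S2 * ?D = t_half_sym n + (- 1) powi d2 * t_half_sym (n - 4 - 4 * d2)"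
    using alternating_sum_torus_2 [of "n - 2" d2] \<open>odd n\<close> \<open>n > 0\<close> d2 by simp
  have ends: "t_half_sym (3 * n - 4 - 4 * d1) = t_half_sym 1"
             "t_half_sym (n - 4 - 4 * d2) = t_half_sym 1"
  proof -
    have "3 * n - 4 - 4 * d1 = 1 \<or> 3 * n - 4 - 4 * d1 = - 1"
         "n - 4 - 4 * d2 = 1 \<or> n - 4 - 4 * d2 = - 1"
      unfolding d1 d2 using \<open>odd n\<close> by presburger+
    then show "t_half_sym (3 * n - 4 - 4 * d1) = t_half_sym 1"
              "t_half_sym (n - 4 - 4 * d2) = t_half_sym 1"
      using t_half_sym_uminus [of 1] by metis+
  qed
  \<comment> \<open>For \<open>n = 4 q + 1\<close> the pair \<open>(d1, d2)\<close> is \<open>(3 q, q - 1)\<close>, and for \<open>n = 4 q + 3\<close> it is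
    \<open>(3 q + 1, q)\<close>.\<close>
  have "even d1 \<longleftrightarrow> odd d2"
    unfolding d1 d2 using \<open>odd n\<close> by presburger
  then have signs: "(- 1 :: rat fls) powi d1 + (- 1) powi d2 = 0"
    by (cases "even d1") (auto simp: power_int_minus_left)
  have "(?S1 + ?S2) * ?D = t_half_sym (3 * n) + t_half_sym n +
      ((- 1) powi d1 + (- 1) powi d2) * t_half_sym 1"
    unfolding distrib_right S1 S2 ends by (simp only: ac_simps)
  then have "(?S1 + ?S2) * ?D = t_half_sym (3 * n) + t_half_sym n"
    by (simp add: signs)
  moreover have "?D \<noteq> 0"
    by (simp add: t_half_sym_nonzero)
  ultimately have "?S1 + ?S2 = (t_half_sym (3 * n) + t_half_sym n) / ?D"
    by (simp only: nonzero_eq_divide_eq not_False_eq_True)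
  then show ?thesis
    using torus_alexander_4_sym [of n] \<open>n > 0\<close> by simp
qed

end
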